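(* Let $a,b>0$ and let $(A,B)$ be a $[0,1]^2$-valued random vector with distribution $\mu$ such that $$\mathbb{P}(|A-B|=1)<1 \quad\text{and}\quad \mathbb{P}(A=1)<1.$$ Suppose that at least one of the following assertions (i), (ii) holds. Then all of the assertions (i)-(v) hold. (i) For $V_2\sim\Gamma_b$, $V_1\sim\Gamma_a$ is the unique (in distribution) solution to $V_1\overset{d}{=}AV_1+BV_2$, where $V_1,V_2,(A,B)$ are mutually independent. (ii) $X\sim\beta(a,b)$ is the unique (in distribution) solution to $X\overset{d}{=}AX+B(1-X)$, where $X$ is independent of $(A,B)$. (iii) There is a random variable $Y\sim\beta(a,b)$ such that, as $n\to\infty$, $Y_n(x)\to Y$ almost surely, uniformly in $x\in[0,1]$. (iv) For every $x\in[0,1]$, $X_n(x)$ converges in distribution to $\beta(a,b)$ as $n\to\infty$. (v) For every $x'\in(0,\infty)$, $X'_n(x')$ converges in distribution to $\Gamma_a$ as $n\to\infty$.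
   Context: $\overset{d}{=}$ denotes equality in distribution. $\beta(a,b)$, $a,b>0$, is the beta distribution with density $B(a,b)^{-1}u^{a-1}(1-u)^{b-1}$ on $(0,1)$. $\Gamma_a$, $a>0$, is the gamma distribution with shape $a$ and scale $1$. $F_1\otimes F_2$ denotes the joint law of independent random elements with laws $F_1$, $F_2$. A solution of a random equation is a real random variable (or its law) satisfying it; uniqueness is in distribution. Let $\mu$ be the law of $(A,B)$ and let $(A_1,B_1,V_1),(A_2,B_2,V_2),\dots$ be i.i.d. with law $\mu\otimes\Gamma_b$. Put $F_n(x)=A_nx+B_n(1-x)$ for $x\in[0,1]$ and $G_n(x')=A_nx'+B_nV_n$ for $x'\in(0,\infty)$. Define, for $n\ge1$, $X_n=F_n\circ F_{n-1}\circ\cdots\circ F_1$ (forward iteration), $Y_n=F_1\circ F_2\circ\cdots\circ F_n$ (backward iteration), and $X'_n=G_n\circ G_{n-1}\circ\cdots\circ G_1$. *)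

theory Defs
  imports "HOL-Probability.Probability"
begin

definition gamma_law :: "real \<Rightarrow> real measure" where
  "gamma_law a = density lborel
     (\<lambda>x. ennreal (indicator {0<..} x * (x powr (a - 1) * exp (- x) / Gamma a)))"

definition beta_law :: "real \<Rightarrow> real \<Rightarrow> real measure" where
  "beta_law a b = density lborel
     (\<lambda>u. ennreal (indicator {0<..<1} u * (u powr (a - 1) * (1 - u) powr (b - 1) / Beta a b)))"

text \<open>Solutions of random equations are represented by their laws, which are arbitrary Borel
  probability measures on the real line (no restriction on the support). Independence of the random
  elements on the right-hand side is expressed by taking their joint law to be a product measure;
  \<open>\<mu>\<close> is the law of the random coefficients \<open>(A, B)\<close>.\<close>

definition gamma_eq_solution :: "(real \<times> real) measure \<Rightarrow> real \<Rightarrow> real measure \<Rightarrow> bool" where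
  "gamma_eq_solution \<mu> b \<nu> \<longleftrightarrow> prob_space \<nu> \<and> sets \<nu> = sets borel \<and>
     distr (\<nu> \<Otimes>\<^sub>M (\<mu> \<Otimes>\<^sub>M gamma_law b)) borel (\<lambda>(v1, (\<alpha>, \<beta>), v2). \<alpha> * v1 + \<beta> * v2) = \<nu>"

definition beta_eq_solution :: "(real \<times> real) measure \<Rightarrow> real measure \<Rightarrow> bool" where
  "beta_eq_solution \<mu> \<nu> \<longleftrightarrow> prob_space \<nu> \<and> sets \<nu> = sets borel \<and>
     distr (\<nu> \<Otimes>\<^sub>M \<mu>) borel (\<lambda>(x, (\<alpha>, \<beta>)). \<alpha> * x + \<beta> * (1 - x)) = \<nu>"

definition unique_solution :: "(real measure \<Rightarrow> bool) \<Rightarrow> real measure \<Rightarrow> bool" where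
  "unique_solution S \<nu> \<longleftrightarrow> S \<nu> \<and> (\<forall>\<nu>'. S \<nu>' \<longrightarrow> \<nu>' = \<nu>)"

text \<open>Iterations of maps indexed from 1: \<open>f n \<circ> \<dots> \<circ> f 1\<close> and \<open>f 1 \<circ> \<dots> \<circ> f n\<close>; the value
  \<open>f 0\<close> is never used.\<close>

primrec forward_iter :: "(nat \<Rightarrow> 'a \<Rightarrow> 'a) \<Rightarrow> nat \<Rightarrow> 'a \<Rightarrow> 'a" where
  "forward_iter f 0 = id"
| "forward_iter f (Suc n) = f (Suc n) \<circ> forward_iter f n"

primrec backward_iter :: "(nat \<Rightarrow> 'a \<Rightarrow> 'a) \<Rightarrow> nat \<Rightarrow> 'a \<Rightarrow> 'a" where
  "backward_iter f 0 = id"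
| "backward_iter f (Suc n) = backward_iter f n \<circ> f (Suc n)"

definition F_map :: "real \<Rightarrow> real \<Rightarrow> real \<Rightarrow> real" where
  "F_map \<alpha> \<beta> x = \<alpha> * x + \<beta> * (1 - x)"

definition G_map :: "real \<Rightarrow> real \<Rightarrow> real \<Rightarrow> real \<Rightarrow> real" where
  "G_map \<alpha> \<beta> v x = \<alpha> * x + \<beta> * v"

end

theory Submission
  imports Defs
begin

text \<open>If \<open>V1 \<sim> \<Gamma>(a)\<close> and \<open>V2 \<sim> \<Gamma>(b)\<close> are independent, then \<open>V1 = S X\<close> and \<open>V2 = S (1 - X)\<close> with
  independent \<open>S \<sim> \<Gamma>(a + b)\<close> and \<open>X \<sim> \<beta>(a, b)\<close>, so \<open>A V1 + B V2 = S (A X + B (1 - X))\<close>. Hence the beta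
  equation implies the gamma equation; conversely the moments of \<open>S\<close> are positive and finite, so the
  gamma equation determines the moments of the bounded variable \<open>A X + B (1 - X)\<close>.

  Both equations have the form \<open>X = C X + D\<close> in law with \<open>\<bar>C\<bar> \<le> 1\<close> and \<open>P(\<bar>C\<bar> = 1) < 1\<close>. For such
  an iteration the product \<open>C\<^sub>1 \<dots> C\<^sub>n\<close> has geometrically decaying first absolute moment and tends to 0
  almost surely, so the starting point is forgotten. Comparing characteristic functions with those of
  the iteration started in a stationary law yields convergence in law of the iterates, and with it
  uniqueness of the stationary law and the law of the almost sure limit of the backward iterates.\<close>

subsection \<open>Beta-gamma algebra\<close>

lemma sets_gamma_law [simp, measurable_cong]: "sets (gamma_law a) = sets borel"
  by (simp add: gamma_law_def)

lemma sets_beta_law [simp, measurable_cong]: "sets (beta_law a b) = sets borel"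
  by (simp add: beta_law_def)

lemma space_gamma_law [simp]: "space (gamma_law a) = UNIV"
  by (simp add: gamma_law_def)

lemma space_beta_law [simp]: "space (beta_law a b) = UNIV"
  by (simp add: beta_law_def)

definition gamma_pdf :: "real \<Rightarrow> real \<Rightarrow> real" where
  "gamma_pdf a x = indicator {0<..} x * (x powr (a - 1) * exp (- x) / Gamma a)"

definition beta_pdf :: "real \<Rightarrow> real \<Rightarrow> real \<Rightarrow> real" where
  "beta_pdf a b u = indicator {0<..<1} u * (u powr (a - 1) * (1 - u) powr (b - 1) / Beta a b)"

lemma gamma_law_eq_density: "gamma_law a = density lborel (gamma_pdf a)"
  by (simp add: gamma_law_def gamma_pdf_def)

lemma beta_law_eq_density: "beta_law a b = density lborel (beta_pdf a b)"
  by (simp add: beta_law_def beta_pdf_def)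

lemma measurable_gamma_pdf [measurable]: "gamma_pdf a \<in> borel_measurable borel"
  unfolding gamma_pdf_def by measurable

lemma measurable_beta_pdf [measurable]: "beta_pdf a b \<in> borel_measurable borel"
  unfolding beta_pdf_def by measurable

lemma gamma_pdf_nonneg: "a > 0 \<Longrightarrow> gamma_pdf a x \<ge> 0"
  by (simp add: gamma_pdf_def Gamma_real_pos less_imp_le)

lemma beta_pdf_nonneg: "a > 0 \<Longrightarrow> b > 0 \<Longrightarrow> beta_pdf a b x \<ge> 0"
  by (simp add: beta_pdf_def Beta_def Gamma_real_pos less_imp_le)

text \<open>Multiplying the density by \<open>x powr r\<close> shifts the shape from
  \<open>a\<close> to \<open>a + r\<close> and leaves Euler's integral for
  \<open>Gamma (a + r)\<close>. The case \<open>r = 0\<close> gives the total mass,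
  \<open>r = n\<close> the power moments.\<close>

lemma nn_integral_gamma_powr:
  assumes "a + r > 0" "a > 0"
  shows "(\<integral>\<^sup>+x. ennreal (x powr r) \<partial>gamma_law a) = ennreal (Gamma (a + r) / Gamma a)"
proof -
  have "(\<integral>\<^sup>+x. ennreal (x powr r) \<partial>gamma_law a) = (\<integral>\<^sup>+x. ennreal (gamma_pdf a x) * ennreal (x powr r) \<partial>lborel)"
    unfolding gamma_law_eq_density by (subst nn_integral_density) auto
  also have "\<dots> = (\<integral>\<^sup>+x. ennreal (1 / Gamma a) *
      ennreal (indicator {0..} x * x powr (a + r - 1) / exp x) \<partial>lborel)"
  proof (rule nn_integral_cong_AE, rule AE_mp[OF AE_lborel_singleton[of 0]], rule AE_I2, intro impI)
    fix x :: real assume "x \<noteq> 0"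
    then show "ennreal (gamma_pdf a x) * ennreal (x powr r) =
      ennreal (1 / Gamma a) * ennreal (indicator {0..} x * x powr (a + r - 1) / exp x)"
      using assms Gamma_real_pos[of a]
      by (auto simp: gamma_pdf_def indicator_def ennreal_mult[symmetric] exp_minus field_simps
          powr_add[symmetric])
  qed
  also have "\<dots> = ennreal (1 / Gamma a) * ennreal (Gamma (a + r))"
    using assms by (subst nn_integral_cmult) (auto simp: Gamma_conv_nn_integral_real)
  also have "\<dots> = ennreal (Gamma (a + r) / Gamma a)"
    using assms Gamma_real_pos[of a] Gamma_real_pos[of "a+r"] by (simp add: ennreal_mult[symmetric])
  finally show ?thesis .
qed

lemma AE_gamma_law: "AE x in gamma_law a. x > 0"
  unfolding gamma_law_eq_density by (subst AE_density) (auto simp: gamma_pdf_def indicator_def)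

lemma AE_beta_law: "AE x in beta_law a b. x > 0 \<and> x < 1"
  unfolding beta_law_eq_density by (subst AE_density) (auto simp: beta_pdf_def indicator_def)

lemma prob_space_gamma_law:
  assumes "a > 0"
  shows "prob_space (gamma_law a)"
proof
  have "emeasure (gamma_law a) (space (gamma_law a)) = (\<integral>\<^sup>+x. 1 \<partial>gamma_law a)"
    by simp
  \<comment> \<open>Only almost everywhere: \<open>0 powr 0 = 0\<close>.\<close>
  also have "\<dots> = (\<integral>\<^sup>+x. ennreal (x powr 0) \<partial>gamma_law a)"
    using AE_gamma_law[of a] by (intro nn_integral_cong_AE) (auto elim: eventually_mono)
  also have "\<dots> = 1"
    using assms less_imp_neq[OF Gamma_real_pos[OF assms]] by (subst nn_integral_gamma_powr) auto
  finally show "emeasure (gamma_law a) (space (gamma_law a)) = 1" .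
qed

text \<open>The factor \<open>s\<close> is the Jacobian of
  \<open>(s, x) \<mapsto> (s * x, s * (1 - x))\<close>. That the transformed joint density splits
  into a function of \<open>s\<close> times a function of \<open>x\<close> is the independence of
  the sum and the ratio.\<close>

lemma gamma_beta_pdf:
  assumes "a > 0" "b > 0" "s > 0"
  shows "s * (gamma_pdf a (s * x) * gamma_pdf b (s * (1 - x))) = gamma_pdf (a + b) s * beta_pdf a b x"
proof (cases "0 < x \<and> x < 1")
  case True
  have p: "s * (s powr (a - 1) * s powr (b - 1)) = s powr (a + b - 1)"
    using assms by (simp add: powr_add[symmetric] powr_mult_base)
  have e: "exp (- (s * x)) * exp (- (s * (1 - x))) = exp (- s)"
    by (simp add: mult_exp_exp algebra_simps)
  have "s * (gamma_pdf a (s * x) * gamma_pdf b (s * (1 - x))) =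
      (s * (s powr (a - 1) * s powr (b - 1))) * (exp (- (s * x)) * exp (- (s * (1 - x)))) *
      (x powr (a - 1) * (1 - x) powr (b - 1)) / (Gamma a * Gamma b)"
    using assms True by (simp add: gamma_pdf_def powr_mult)
  also have "\<dots> = gamma_pdf (a + b) s * beta_pdf a b x"
    unfolding p e
    using assms True less_imp_neq[OF Gamma_real_pos[OF add_pos_pos[OF assms(1,2)]]]
    by (simp add: gamma_pdf_def beta_pdf_def Beta_def)
  finally show ?thesis .
next
  case False
  then show ?thesis
    using assms by (auto simp: gamma_pdf_def beta_pdf_def indicator_def zero_less_mult_iff)
qed

text \<open>The beta-gamma independence in integrated form. Two one-dimensional substitutions
  replace the planar change of variables, and nonnegativity of \<open>f\<close> lets Tonelli apply
  without integrability conditions.\<close>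

lemma nn_integral_gamma_gamma:
  fixes f :: "real \<Rightarrow> real \<Rightarrow> ennreal"
  assumes "a > 0" "b > 0" and f [measurable]: "case_prod f \<in> borel_measurable (borel \<Otimes>\<^sub>M borel)"
  shows "(\<integral>\<^sup>+v. \<integral>\<^sup>+w. f v w \<partial>gamma_law b \<partial>gamma_law a) =
         (\<integral>\<^sup>+s. \<integral>\<^sup>+x. f (s * x) (s * (1 - x)) \<partial>beta_law a b \<partial>gamma_law (a + b))"
proof -
  define h where "h v w = ennreal (gamma_pdf a v) * ennreal (gamma_pdf b w) * f v w" for v w
  have h [measurable]: "case_prod h \<in> borel_measurable (borel \<Otimes>\<^sub>M borel)"
    unfolding h_def by measurable
  have "(\<integral>\<^sup>+v. \<integral>\<^sup>+w. f v w \<partial>gamma_law b \<partial>gamma_law a) =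
      (\<integral>\<^sup>+v. ennreal (gamma_pdf a v) * (\<integral>\<^sup>+w. ennreal (gamma_pdf b w) * f v w \<partial>lborel) \<partial>lborel)"
    unfolding gamma_law_eq_density by (simp add: nn_integral_density)
  also have "\<dots> = (\<integral>\<^sup>+v. \<integral>\<^sup>+w. h v w \<partial>lborel \<partial>lborel)"
    by (simp add: nn_integral_cmult[symmetric] h_def mult.assoc)
  \<comment> \<open>First substitution: the sum \<open>s = v + w\<close> replaces
    \<open>w\<close>.\<close>
  also have "\<dots> = (\<integral>\<^sup>+v. \<integral>\<^sup>+s. h v (s - v) \<partial>lborel \<partial>lborel)"
  proof (rule nn_integral_cong)
    fix v :: real
    show "(\<integral>\<^sup>+w. h v w \<partial>lborel) = (\<integral>\<^sup>+s. h v (s - v) \<partial>lborel)"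
      using nn_integral_real_affine[of "h v" 1 "- v"] by simp
  qed
  also have "\<dots> = (\<integral>\<^sup>+s. \<integral>\<^sup>+v. h v (s - v) \<partial>lborel \<partial>lborel)"
    by (rule lborel_pair.Fubini'[symmetric]) measurable
  also have "\<dots> = (\<integral>\<^sup>+s. \<integral>\<^sup>+x. ennreal (gamma_pdf (a + b) s) * (ennreal (beta_pdf a b x) *
      f (s * x) (s * (1 - x))) \<partial>lborel \<partial>lborel)"
  proof (rule nn_integral_cong)
    fix s :: real
    show "(\<integral>\<^sup>+v. h v (s - v) \<partial>lborel) = (\<integral>\<^sup>+x. ennreal (gamma_pdf (a + b) s) *
      (ennreal (beta_pdf a b x) * f (s * x) (s * (1 - x))) \<partial>lborel)"
    proof (cases "s > 0")
      case True
      \<comment> \<open>Second substitution: the ratio \<open>x = v / s\<close> replaces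
        \<open>v\<close>, with Jacobian \<open>s\<close>.\<close>
      have "(\<integral>\<^sup>+v. h v (s - v) \<partial>lborel) = (\<integral>\<^sup>+x. ennreal s * h (s * x) (s * (1 - x)) \<partial>lborel)"
        using nn_integral_real_affine[of "\<lambda>v. h v (s - v)" s 0] True
        by (simp add: nn_integral_cmult right_diff_distrib)
      also have "\<dots> = (\<integral>\<^sup>+x. ennreal (gamma_pdf (a + b) s) *
        (ennreal (beta_pdf a b x) * f (s * x) (s * (1 - x))) \<partial>lborel)"
      proof (rule nn_integral_cong)
        fix x :: real
        have "ennreal s * h (s * x) (s * (1 - x)) =
          ennreal (s * (gamma_pdf a (s * x) * gamma_pdf b (s * (1 - x)))) * f (s * x) (s * (1 - x))"
          using assms True gamma_pdf_nonneg by (simp add: h_def ennreal_mult mult.assoc)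
        also have "\<dots> = ennreal (gamma_pdf (a + b) s) *
          (ennreal (beta_pdf a b x) * f (s * x) (s * (1 - x)))"
          using assms True
          by (simp add: gamma_beta_pdf gamma_pdf_nonneg beta_pdf_nonneg ennreal_mult mult.assoc)
        finally show "ennreal s * h (s * x) (s * (1 - x)) = \<dots>" .
      qed
      finally show ?thesis .
    next
      case False
      \<comment> \<open>If \<open>s \<le> 0\<close>, then \<open>v\<close> and \<open>s - v\<close>
        cannot both be positive, so one of the two densities vanishes.\<close>
      then have "h v (s - v) = 0" for v
        by (cases "v > 0") (auto simp: h_def gamma_pdf_def)
      then show ?thesis
        using False by (simp add: gamma_pdf_def)
    qed
  qed
  also have "\<dots> = (\<integral>\<^sup>+s. \<integral>\<^sup>+x. f (s * x) (s * (1 - x)) \<partial>beta_law a b \<partial>gamma_law (a + b))"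
    unfolding gamma_law_eq_density beta_law_eq_density
    by (simp add: nn_integral_density nn_integral_cmult)
  finally show ?thesis .
qed

text \<open>The constant function \<open>1\<close> in the gamma-gamma identity yields the total
  mass, since all the gamma laws involved have mass 1.\<close>

lemma prob_space_beta_law:
  assumes "a > 0" "b > 0"
  shows "prob_space (beta_law a b)"
proof
  interpret A: prob_space "gamma_law a" using assms by (simp add: prob_space_gamma_law)
  interpret B: prob_space "gamma_law b" using assms by (simp add: prob_space_gamma_law)
  interpret AB: prob_space "gamma_law (a + b)" using assms by (simp add: prob_space_gamma_law)
  show "emeasure (beta_law a b) (space (beta_law a b)) = 1"
    using nn_integral_gamma_gamma[OF assms, of "\<lambda>_ _. 1"]
      A.emeasure_space_1 B.emeasure_space_1 AB.emeasure_space_1 by simp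
qed

section \<open>Moment determinacy and the equivalence of the gamma and beta equations\<close>

text \<open>On \<open>[-1, 1]\<close> the Taylor remainder of the characteristic function at order
  \<open>n\<close> is at most \<open>2 * \<bar>t\<bar> ^ n / fact n\<close>, which tends to 0. So
  the moments fix the characteristic function, and this fixes the law.\<close>

lemma bounded_moments_unique:
  fixes M N :: "real measure"
  assumes "real_distribution M" "real_distribution N"
    and M01: "AE x in M. \<bar>x\<bar> \<le> 1" and N01: "AE x in N. \<bar>x\<bar> \<le> 1"
    and eq: "\<And>n. (\<integral>x. x ^ n \<partial>M) = (\<integral>x. x ^ n \<partial>N)"
  shows "M = N"
proof -
  interpret M: real_distribution M by fact
  interpret N: real_distribution N by fact
  have approx: "(\<lambda>n. \<Sum>k\<le>n. ((\<i> * t) ^ k / fact k) * (\<integral>x. x ^ k \<partial>P)) \<longlonglongrightarrow> char P t"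
    if "real_distribution P" and P01: "AE x in P. \<bar>x\<bar> \<le> 1" for P t
  proof -
    interpret P: real_distribution P by fact
    have abs_le: "AE x in P. \<bar>x ^ k\<bar> \<le> 1" for k
      using P01 by eventually_elim (simp add: power_abs power_le_one)
    have int: "integrable P (\<lambda>x. x ^ k)" for k
      using abs_le by (intro P.integrable_const_bound[of _ 1]) auto
    have "(\<lambda>n. 2 * (inverse (fact n) * \<bar>t\<bar> ^ n)) \<longlonglongrightarrow> 2 * 0"
      by (intro tendsto_mult tendsto_const summable_LIMSEQ_zero[OF summable_exp])
    then have lim: "(\<lambda>n. 2 * \<bar>t\<bar> ^ n / fact n) \<longlonglongrightarrow> 0"
      by (simp add: field_simps)
    have bound: "norm ((\<Sum>k\<le>n. ((\<i> * t) ^ k / fact k) * (\<integral>x. x ^ k \<partial>P)) - char P t) \<le> 2 * \<bar>t\<bar> ^ n / fact n" for n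
    proof -
      have "(\<integral>x. \<bar>x\<bar> ^ n \<partial>P) \<le> (\<integral>x. 1 \<partial>P)"
        using abs_le[of n] int[of n] by (intro integral_mono_AE) (auto simp: power_abs[symmetric])
      then have "(\<integral>x. \<bar>x\<bar> ^ n \<partial>P) \<le> 1"
        using P.prob_space by simp
      then have "(2 * \<bar>t\<bar> ^ n / fact n) * (\<integral>x. \<bar>x\<bar> ^ n \<partial>P) \<le> (2 * \<bar>t\<bar> ^ n / fact n) * 1"
        by (intro mult_left_mono) auto
      then show ?thesis
        using P.char_approx1[of n t, OF int] by (subst norm_minus_commute) simp
    qed
    have "(\<lambda>n. (\<Sum>k\<le>n. ((\<i> * t) ^ k / fact k) * (\<integral>x. x ^ k \<partial>P)) - char P t) \<longlonglongrightarrow> 0"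
      using lim by (rule Lim_null_comparison[OF always_eventually, rotated]) (intro allI bound)
    then show ?thesis
      by (rule LIM_zero_cancel)
  qed
  have "char M t = char N t" for t
    using approx[OF assms(1) M01, of t] approx[OF assms(2) N01, of t] eq by (simp add: LIMSEQ_unique)
  then show ?thesis
    using assms by (intro Levy_uniqueness) auto
qed

text \<open>This transfers only the property of being a solution. Uniqueness comes later, for each
  equation separately, from \<open>stationary_unique\<close>.\<close>

lemma gamma_eq_solution_iff_beta_eq_solution:
  fixes \<mu> :: "(real \<times> real) measure"
  assumes a: "a > 0" and b: "b > 0" and "prob_space \<mu>" and sets_\<mu> [measurable_cong]: "sets \<mu> = sets borel"
    and \<mu>01: "AE z in \<mu>. 0 \<le> fst z \<and> fst z \<le> 1 \<and> 0 \<le> snd z \<and> snd z \<le> 1"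
  shows "gamma_eq_solution \<mu> b (gamma_law a) \<longleftrightarrow> beta_eq_solution \<mu> (beta_law a b)"
proof -
  interpret \<mu>: prob_space \<mu> by fact
  interpret GA: prob_space "gamma_law a" using a by (rule prob_space_gamma_law)
  interpret GB: prob_space "gamma_law b" using b by (rule prob_space_gamma_law)
  interpret G: prob_space "gamma_law (a + b)" using a b by (simp add: prob_space_gamma_law)
  interpret Be: prob_space "beta_law a b" using a b by (rule prob_space_beta_law)
  interpret \<mu>B: pair_prob_space \<mu> "gamma_law b" ..
  interpret A\<mu>: pair_prob_space "gamma_law a" \<mu> ..
  interpret G\<mu>: pair_prob_space "gamma_law (a + b)" \<mu> ..
  interpret Be\<mu>: pair_prob_space "beta_law a b" \<mu> ..
  \<comment> \<open>\<open>L\<close> and \<open>T\<close> are the laws of the two right-hand sides,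
    so the claim becomes
    \<open>L = gamma_law a \<longleftrightarrow> T = beta_law a b\<close>.\<close>
  define L where "L = distr (gamma_law a \<Otimes>\<^sub>M (\<mu> \<Otimes>\<^sub>M gamma_law b)) borel
    (\<lambda>(v1, (\<alpha>, \<beta>), v2). \<alpha> * v1 + \<beta> * v2)"
  define T where "T = distr (beta_law a b \<Otimes>\<^sub>M \<mu>) borel (\<lambda>(x, (\<alpha>, \<beta>)). \<alpha> * x + \<beta> * (1 - x))"
  have [measurable]: "fst \<in> borel_measurable \<mu>" "snd \<in> borel_measurable \<mu>"
    by (simp_all add: measurable_cong_sets[OF sets_\<mu> refl] borel_measurable_continuous_onI continuous_on_fst continuous_on_snd continuous_on_id)
  have [measurable]: "(\<lambda>(v1, (\<alpha>, \<beta>), v2). \<alpha> * v1 + \<beta> * v2) \<in> borel_measurable (gamma_law a \<Otimes>\<^sub>M (\<mu> \<Otimes>\<^sub>M gamma_law b))"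
    unfolding split_beta' by measurable
  have [measurable]: "(\<lambda>(x, (\<alpha>, \<beta>)). \<alpha> * x + \<beta> * (1 - x)) \<in> borel_measurable (beta_law a b \<Otimes>\<^sub>M \<mu>)"
    unfolding split_beta' by measurable
  interpret T: prob_space T
    unfolding T_def by (intro Be\<mu>.prob_space_distr) measurable
  have sets_T [measurable_cong]: "sets T = sets borel" and sets_L [measurable_cong]: "sets L = sets borel"
    by (simp_all add: T_def L_def)
  \<comment> \<open>\<open>L\<close> is the law of \<open>S * W\<close> with independent
    \<open>S \<sim> gamma_law (a + b)\<close> and \<open>W \<sim> T\<close>: fix the coefficients
    \<open>e\<close>, apply the beta-gamma identity to the two gamma variables, then move
    \<open>s\<close> outermost and collect \<open>x\<close> and \<open>e\<close> into
    \<open>T\<close>.\<close>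
  have L_eq: "(\<integral>\<^sup>+v. g v \<partial>L) = (\<integral>\<^sup>+s. \<integral>\<^sup>+w. g (s * w) \<partial>T \<partial>gamma_law (a + b))"
    if g [measurable]: "g \<in> borel_measurable borel" for g :: "real \<Rightarrow> ennreal"
  proof -
    have "(\<integral>\<^sup>+v. g v \<partial>L) = (\<integral>\<^sup>+z. g (fst (fst (snd z)) * fst z + snd (fst (snd z)) * snd (snd z))
        \<partial>(gamma_law a \<Otimes>\<^sub>M (\<mu> \<Otimes>\<^sub>M gamma_law b)))"
      unfolding L_def by (subst nn_integral_distr) (auto simp: split_beta')
    also have "\<dots> = (\<integral>\<^sup>+v. \<integral>\<^sup>+y. g (fst (fst y) * v + snd (fst y) * snd y) \<partial>(\<mu> \<Otimes>\<^sub>M gamma_law b) \<partial>gamma_law a)"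
      by (subst \<mu>B.nn_integral_fst[symmetric]) auto
    also have "\<dots> = (\<integral>\<^sup>+v. \<integral>\<^sup>+e. \<integral>\<^sup>+w. g (fst e * v + snd e * w) \<partial>gamma_law b \<partial>\<mu> \<partial>gamma_law a)"
      by (subst GB.nn_integral_fst[symmetric]) auto
    also have "\<dots> = (\<integral>\<^sup>+e. \<integral>\<^sup>+v. \<integral>\<^sup>+w. g (fst e * v + snd e * w) \<partial>gamma_law b \<partial>gamma_law a \<partial>\<mu>)"
      by (rule A\<mu>.Fubini'[symmetric]) measurable
    also have "\<dots> = (\<integral>\<^sup>+e. \<integral>\<^sup>+s. \<integral>\<^sup>+x. g (s * (fst e * x + snd e * (1 - x)))
        \<partial>beta_law a b \<partial>gamma_law (a + b) \<partial>\<mu>)"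
    proof (rule nn_integral_cong)
      fix e
      show "(\<integral>\<^sup>+v. \<integral>\<^sup>+w. g (fst e * v + snd e * w) \<partial>gamma_law b \<partial>gamma_law a) =
        (\<integral>\<^sup>+s. \<integral>\<^sup>+x. g (s * (fst e * x + snd e * (1 - x))) \<partial>beta_law a b \<partial>gamma_law (a + b))"
        by (subst nn_integral_gamma_gamma[OF a b]) (auto simp: algebra_simps)
    qed
    also have "\<dots> = (\<integral>\<^sup>+s. \<integral>\<^sup>+e. \<integral>\<^sup>+x. g (s * (fst e * x + snd e * (1 - x)))
        \<partial>beta_law a b \<partial>\<mu> \<partial>gamma_law (a + b))"
      by (rule G\<mu>.Fubini') measurable
    also have "\<dots> = (\<integral>\<^sup>+s. \<integral>\<^sup>+w. g (s * w) \<partial>T \<partial>gamma_law (a + b))"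
    proof (rule nn_integral_cong)
      fix s :: real
      have "(\<integral>\<^sup>+e. \<integral>\<^sup>+x. g (s * (fst e * x + snd e * (1 - x))) \<partial>beta_law a b \<partial>\<mu>) =
          (\<integral>\<^sup>+x. \<integral>\<^sup>+e. g (s * (fst e * x + snd e * (1 - x))) \<partial>\<mu> \<partial>beta_law a b)"
        by (rule Be\<mu>.Fubini') measurable
      also have "\<dots> = (\<integral>\<^sup>+z. g (s * (fst (snd z) * fst z + snd (snd z) * (1 - fst z))) \<partial>(beta_law a b \<Otimes>\<^sub>M \<mu>))"
        by (subst \<mu>.nn_integral_fst[symmetric]) auto
      also have "\<dots> = (\<integral>\<^sup>+w. g (s * w) \<partial>T)"
        unfolding T_def by (subst nn_integral_distr) (auto simp: split_beta')
      finally show "(\<integral>\<^sup>+e. \<integral>\<^sup>+x. g (s * (fst e * x + snd e * (1 - x))) \<partial>beta_law a b \<partial>\<mu>) =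
        (\<integral>\<^sup>+w. g (s * w) \<partial>T)" .
    qed
    finally show ?thesis .
  qed
  \<comment> \<open>Likewise \<open>gamma_law a\<close> is the law of \<open>S * X\<close> with
    \<open>X \<sim> beta_law a b\<close>, by a test function that ignores the second
    variable.\<close>
  have GA_eq: "(\<integral>\<^sup>+v. g v \<partial>gamma_law a) = (\<integral>\<^sup>+s. \<integral>\<^sup>+x. g (s * x) \<partial>beta_law a b \<partial>gamma_law (a + b))"
    if [measurable]: "g \<in> borel_measurable borel" for g :: "real \<Rightarrow> ennreal"
    using nn_integral_gamma_gamma[OF a b, of "\<lambda>v _. g v"] GB.emeasure_space_1 by simp
  \<comment> \<open>\<open>T\<close> is carried by convex combinations, with weights
    \<open>x\<close> and \<open>1 - x\<close>, of two coefficients in \<open>[0, 1]\<close>.\<close>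
  have T01: "AE x in T. 0 \<le> x \<and> x \<le> 1"
  proof -
    have "AE z in beta_law a b \<Otimes>\<^sub>M \<mu>. 0 \<le> fst (snd z) * fst z + snd (snd z) * (1 - fst z) \<and>
        fst (snd z) * fst z + snd (snd z) * (1 - fst z) \<le> 1"
    proof (rule Be\<mu>.AE_pair_measure)
      show "{z \<in> space (beta_law a b \<Otimes>\<^sub>M \<mu>). 0 \<le> fst (snd z) * fst z + snd (snd z) * (1 - fst z) \<and>
        fst (snd z) * fst z + snd (snd z) * (1 - fst z) \<le> 1} \<in> sets (beta_law a b \<Otimes>\<^sub>M \<mu>)"
        by measurable
      show "AE x in beta_law a b. AE y in \<mu>. 0 \<le> fst (snd (x, y)) * fst (x, y) + snd (snd (x, y)) * (1 - fst (x, y)) \<and>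
        fst (snd (x, y)) * fst (x, y) + snd (snd (x, y)) * (1 - fst (x, y)) \<le> 1"
        using AE_beta_law
      proof eventually_elim
        case (elim x)
        show ?case
          using \<mu>01
        proof eventually_elim
          case (elim y)
          then show ?case
            using \<open>0 < x \<and> x < 1\<close> convex_bound_le[of "fst y" 1 "snd y" x "1 - x"]
            by (simp add: mult.commute)
        qed
      qed
    qed
    then show ?thesis
      unfolding T_def by (subst AE_distr_iff) (auto simp: split_beta')
  qed
  have "L = gamma_law a \<longleftrightarrow> T = beta_law a b"
  proof
    assume T: "T = beta_law a b"
    show "L = gamma_law a"
    proof (rule measure_eqI)
      fix X assume "X \<in> sets L"
      then have X [measurable]: "X \<in> sets borel" by (simp add: sets_L)
      have "emeasure L X = (\<integral>\<^sup>+v. indicator X v \<partial>L)"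
        using X by (simp add: sets_L)
      also have "\<dots> = (\<integral>\<^sup>+v. indicator X v \<partial>gamma_law a)"
        using L_eq[of "indicator X"] GA_eq[of "indicator X"] T by (simp del: nn_integral_indicator)
      also have "\<dots> = emeasure (gamma_law a) X"
        using X by simp
      finally show "emeasure L X = emeasure (gamma_law a) X" .
    qed (simp add: sets_L)
  next
    assume L: "L = gamma_law a"
    have moment: "(\<integral>\<^sup>+v. ennreal (v ^ n) \<partial>gamma_law a) =
        (\<integral>\<^sup>+s. ennreal (s ^ n) \<partial>gamma_law (a + b)) * (\<integral>\<^sup>+x. ennreal (x ^ n) \<partial>P)"
      if eq: "(\<integral>\<^sup>+v. ennreal (v ^ n) \<partial>gamma_law a) = (\<integral>\<^sup>+s. \<integral>\<^sup>+x. ennreal ((s * x) ^ n) \<partial>P \<partial>gamma_law (a + b))"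
        and [measurable_cong]: "sets P = sets borel" and "AE x in P. 0 \<le> x" for P n
    proof -
      have "(\<integral>\<^sup>+s. \<integral>\<^sup>+x. ennreal ((s * x) ^ n) \<partial>P \<partial>gamma_law (a + b)) =
          (\<integral>\<^sup>+s. ennreal (s ^ n) * (\<integral>\<^sup>+x. ennreal (x ^ n) \<partial>P) \<partial>gamma_law (a + b))"
      proof (rule nn_integral_cong_AE, use AE_gamma_law in eventually_elim)
        case (elim s)
        have "(\<integral>\<^sup>+x. ennreal ((s * x) ^ n) \<partial>P) = (\<integral>\<^sup>+x. ennreal (s ^ n) * ennreal (x ^ n) \<partial>P)"
          using elim by (intro nn_integral_cong) (simp add: power_mult_distrib ennreal_mult')
        then show ?case
          by (simp add: nn_integral_cmult)
      qed
      then show ?thesis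
        by (simp add: eq nn_integral_multc)
    qed
    have "(\<integral>x. x ^ n \<partial>T) = (\<integral>x. x ^ n \<partial>beta_law a b)" for n
    proof -
      let ?m = "\<integral>\<^sup>+s. ennreal (s ^ n) \<partial>gamma_law (a + b)"
      have "?m = (\<integral>\<^sup>+s. ennreal (s powr real n) \<partial>gamma_law (a + b))"
        using AE_gamma_law[of "a + b"]
        by (intro nn_integral_cong_AE) (auto simp: powr_realpow elim!: eventually_mono)
      also have "\<dots> = ennreal (Gamma (a + b + n) / Gamma (a + b))"
        using a b by (intro nn_integral_gamma_powr) auto
      finally have m: "?m = ennreal (Gamma (a + b + n) / Gamma (a + b))" .
      \<comment> \<open>The common moment of \<open>S\<close> is positive and finite, hence can be
        cancelled in the extended nonnegative reals.\<close>
      have m0: "?m \<noteq> 0" "?m \<noteq> top"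
        using a b unfolding m by (auto simp: Gamma_real_pos ennreal_eq_0_iff not_le)
      have "?m * (\<integral>\<^sup>+x. ennreal (x ^ n) \<partial>T) = ?m * (\<integral>\<^sup>+x. ennreal (x ^ n) \<partial>beta_law a b)"
        using AE_beta_law[of a b] T01 L_eq[of "\<lambda>v. ennreal (v ^ n)"] GA_eq[of "\<lambda>v. ennreal (v ^ n)"]
        by (subst (1 2) moment[symmetric]) (auto simp: L sets_T elim: eventually_mono)
      then have "(\<integral>\<^sup>+x. ennreal (x ^ n) \<partial>T) = (\<integral>\<^sup>+x. ennreal (x ^ n) \<partial>beta_law a b)"
        using m0 by (simp add: ennreal_mult_cancel_left)
      moreover have "(\<integral>x. x ^ n \<partial>T) = enn2real (\<integral>\<^sup>+x. ennreal (x ^ n) \<partial>T)"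
        using T01 by (intro integral_eq_nn_integral) (auto elim: eventually_mono)
      moreover have "(\<integral>x. x ^ n \<partial>beta_law a b) = enn2real (\<integral>\<^sup>+x. ennreal (x ^ n) \<partial>beta_law a b)"
        using AE_beta_law[of a b] by (intro integral_eq_nn_integral) (auto elim: eventually_mono)
      ultimately show ?thesis by simp
    qed
    then show "T = beta_law a b"
      using T01 AE_beta_law[of a b] sets_T T.prob_space_axioms Be.prob_space_axioms
      by (intro bounded_moments_unique)
        (auto simp: real_distribution_def real_distribution_axioms_def elim: eventually_mono)
  qed
  then show ?thesis
    unfolding gamma_eq_solution_def beta_eq_solution_def L_def[symmetric] T_def[symmetric]
    using GA.prob_space_axioms Be.prob_space_axioms by simp
qed

subsection \<open>Iterations of random affine maps\<close>

primrec markov_chain :: "('s \<Rightarrow> 'e \<Rightarrow> 's) \<Rightarrow> 's \<Rightarrow> (nat \<Rightarrow> 'e) \<Rightarrow> nat \<Rightarrow> 's" where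
  "markov_chain h z e 0 = z"
| "markov_chain h z e (Suc n) = h (markov_chain h z e n) (e (Suc n))"

lemma markov_chain_cong:
  "(\<And>i. i \<in> {1..n} \<Longrightarrow> e i = e' i) \<Longrightarrow> markov_chain h z e n = markov_chain h z e' n"
  by (induction n) auto

lemma measurable_markov_chain:
  assumes h: "case_prod h \<in> S \<Otimes>\<^sub>M K \<rightarrow>\<^sub>M S" and z: "z \<in> space S"
    and e: "\<And>i. i \<in> {1..n} \<Longrightarrow> (\<lambda>\<omega>. e \<omega> i) \<in> P \<rightarrow>\<^sub>M K"
  shows "(\<lambda>\<omega>. markov_chain h z (e \<omega>) n) \<in> P \<rightarrow>\<^sub>M S"
  using e
proof (induction n)
  case 0
  then show ?case using z by simp
next
  case (Suc n)
  then have "(\<lambda>\<omega>. (markov_chain h z (e \<omega>) n, e \<omega> (Suc n))) \<in> P \<rightarrow>\<^sub>M S \<Otimes>\<^sub>M K"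
    by (intro measurable_Pair) auto
  from measurable_compose[OF this h] show ?case by simp
qed

text \<open>This is independence of \<open>markov_chain h z \<xi> n\<close> and \<open>\<xi> (Suc n)\<close>;
  \<^const>\<open>prob_space.indep_var\<close> would force both to have the same type.\<close>

lemma (in prob_space) distr_markov_chain_next:
  fixes n :: nat
  assumes ind: "indep_vars (\<lambda>_. K) \<xi> {1..}"
    and h: "case_prod h \<in> S \<Otimes>\<^sub>M K \<rightarrow>\<^sub>M S" and z: "z \<in> space S"
  defines "Z \<equiv> \<lambda>\<omega>. markov_chain h z (\<lambda>i. \<xi> i \<omega>) n"
  shows "distr M (S \<Otimes>\<^sub>M K) (\<lambda>\<omega>. (Z \<omega>, \<xi> (Suc n) \<omega>)) = distr M S Z \<Otimes>\<^sub>M distr M K (\<xi> (Suc n))"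
proof -
  \<comment> \<open>The state at time \<open>n\<close> depends only on the block
    \<open>{1..n}\<close> of the noise, which is disjoint from \<open>{Suc n}\<close>; independence
    of the blocks then passes to functions of them.\<close>
  let ?past = "\<lambda>\<omega>. restrict (\<lambda>i. \<xi> i \<omega>) {1..n}" and ?next = "\<lambda>\<omega>. restrict (\<lambda>i. \<xi> i \<omega>) {Suc n}"
  let ?P = "PiM {1..n} (\<lambda>_. K)" and ?N = "PiM {Suc n} (\<lambda>_. K)"
  let ?f = "\<lambda>x. markov_chain h z x n" and ?g = "\<lambda>x. x (Suc n)"
  have "indep_var ?P ?past ?N ?next"
    by (rule indep_var_restrict[OF ind]) auto
  then have past [measurable]: "?past \<in> M \<rightarrow>\<^sub>M ?P" and "next" [measurable]: "?next \<in> M \<rightarrow>\<^sub>M ?N"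
    and joint: "distr M ?P ?past \<Otimes>\<^sub>M distr M ?N ?next = distr M (?P \<Otimes>\<^sub>M ?N) (\<lambda>\<omega>. (?past \<omega>, ?next \<omega>))"
    by (simp_all add: indep_var_distribution_eq)
  have f [measurable]: "?f \<in> ?P \<rightarrow>\<^sub>M S"
    using h z by (rule measurable_markov_chain) (rule measurable_component_singleton)
  have g [measurable]: "?g \<in> ?N \<rightarrow>\<^sub>M K"
    by (rule measurable_component_singleton) simp
  have fZ: "?f (?past \<omega>) = Z \<omega>" for \<omega>
    unfolding Z_def by (rule markov_chain_cong) auto
  have "prob_space (distr (distr M ?N ?next) K ?g)"
    by (intro prob_space.prob_space_distr prob_space_distr) measurable
  then have "distr (distr M ?P ?past) S ?f \<Otimes>\<^sub>M distr (distr M ?N ?next) K ?g =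
      distr (distr M ?P ?past \<Otimes>\<^sub>M distr M ?N ?next) (S \<Otimes>\<^sub>M K) (\<lambda>(x, y). (?f x, ?g y))"
    by (intro pair_measure_distr) (simp_all only: measurable_distr_eq1 f g prob_space_imp_sigma_finite)
  then show ?thesis
    unfolding joint
    by (simp add: distr_distr comp_def fZ del: One_nat_def)
qed

text \<open>Slope and intercept are functions of a general noise, so that both
  \<open>((A, B), V)\<close> and \<open>(A, B)\<close> can drive the iteration. The two conditions
  on \<open>c\<close> force its mean absolute value below 1; \<open>d\<close> is not assumed
  bounded, as the intercept \<open>B * V\<close> of the gamma equation need not be.\<close>

locale random_affine_iteration = prob_space M + noise: prob_space \<kappa>
  for M :: "'m measure" and \<kappa> :: "'e::topological_space measure" +
  fixes \<xi> :: "nat \<Rightarrow> 'm \<Rightarrow> 'e" and c d :: "'e \<Rightarrow> real"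
  assumes sets_noise [measurable_cong]: "sets \<kappa> = sets borel"
    and indep: "indep_vars (\<lambda>_. borel) \<xi> {1..}"
    and law: "n \<ge> 1 \<Longrightarrow> distr M borel (\<xi> n) = \<kappa>"
    and c_meas [measurable]: "c \<in> borel_measurable borel"
    and d_meas [measurable]: "d \<in> borel_measurable borel"
    and c_le_1: "AE e in \<kappa>. \<bar>c e\<bar> \<le> 1"
    and c_not_1: "\<not> (AE e in \<kappa>. \<bar>c e\<bar> = 1)"
begin

text \<open>A pair \<open>(p, q)\<close> encodes the affine map \<open>x \<mapsto> p * x + q\<close>; \<open>fwd\<close> composes it with a new
  random map on the left, \<open>bwd\<close> on the right.\<close>

definition fwd :: "real \<times> real \<Rightarrow> 'e \<Rightarrow> real \<times> real" where
  "fwd z e = (fst z * c e, c e * snd z + d e)"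

definition bwd :: "real \<times> real \<Rightarrow> 'e \<Rightarrow> real \<times> real" where
  "bwd z e = (fst z * c e, snd z + fst z * d e)"

abbreviation fwd_chain :: "nat \<Rightarrow> 'm \<Rightarrow> real \<times> real" where
  "fwd_chain n \<omega> \<equiv> markov_chain fwd (1, 0) (\<lambda>i. \<xi> i \<omega>) n"

abbreviation bwd_chain :: "nat \<Rightarrow> 'm \<Rightarrow> real \<times> real" where
  "bwd_chain n \<omega> \<equiv> markov_chain bwd (1, 0) (\<lambda>i. \<xi> i \<omega>) n"

abbreviation step :: "'m \<Rightarrow> nat \<Rightarrow> real \<Rightarrow> real" where
  "step \<omega> n x \<equiv> c (\<xi> n \<omega>) * x + d (\<xi> n \<omega>)"

text \<open>The slope of the \<open>n\<close>-fold composition; as slopes commute, it is the same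
  for the forward and the backward order.\<close>

definition contraction :: "nat \<Rightarrow> 'm \<Rightarrow> real" where
  "contraction n \<omega> = (\<Prod>i\<in>{1..n}. c (\<xi> i \<omega>))"

definition stationary :: "real measure \<Rightarrow> bool" where
  "stationary \<nu> \<longleftrightarrow> prob_space \<nu> \<and> sets \<nu> = sets borel \<and>
     distr (\<nu> \<Otimes>\<^sub>M \<kappa>) borel (\<lambda>(x, e). c e * x + d e) = \<nu>"

lemma measurable_xi [measurable]: "n \<ge> 1 \<Longrightarrow> \<xi> n \<in> borel_measurable M"
  using indep by (simp add: indep_vars_def)

lemma AE_noise:
  assumes "AE e in \<kappa>. P e" "n \<ge> 1"
  shows "AE \<omega> in M. P (\<xi> n \<omega>)"
proof -
  have "AE e in distr M borel (\<xi> n). P e"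
    unfolding law[OF assms(2)] by (fact assms(1))
  then show ?thesis
    using assms(2) by (intro AE_distrD[of "\<xi> n" M borel]) auto
qed

lemma fst_fwd_chain: "fst (fwd_chain n \<omega>) = contraction n \<omega>"
  by (induction n) (auto simp: fwd_def contraction_def)

lemma fst_bwd_chain: "fst (bwd_chain n \<omega>) = contraction n \<omega>"
  by (induction n) (auto simp: bwd_def contraction_def)

lemma forward_iter_eq:
  "forward_iter (step \<omega>) n x = contraction n \<omega> * x + snd (fwd_chain n \<omega>)"
  by (induction n)
    (auto simp: fwd_def contraction_def algebra_simps)

lemma backward_iter_eq:
  "backward_iter (step \<omega>) n x = contraction n \<omega> * x + snd (bwd_chain n \<omega>)"
  \<comment> \<open>The new map is innermost, so the induction hypothesis is applied at the image of
    \<open>x\<close> under it.\<close>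
  by (induction n arbitrary: x)
    (auto simp: bwd_def fst_bwd_chain contraction_def algebra_simps)

lemma measurable_fwd: "case_prod fwd \<in> borel \<Otimes>\<^sub>M borel \<rightarrow>\<^sub>M borel"
  unfolding fwd_def split_beta' borel_prod[symmetric] by measurable

lemma measurable_bwd: "case_prod bwd \<in> borel \<Otimes>\<^sub>M borel \<rightarrow>\<^sub>M borel"
  unfolding bwd_def split_beta' borel_prod[symmetric] by measurable

lemma measurable_fwd_chain [measurable]: "fwd_chain n \<in> borel_measurable M"
  by (rule measurable_markov_chain[OF measurable_fwd]) auto

lemma measurable_bwd_chain [measurable]: "bwd_chain n \<in> borel_measurable M"
  by (rule measurable_markov_chain[OF measurable_bwd]) auto

section \<open>Almost sure decay of the contraction factor\<close>

lemma measurable_contraction [measurable]: "contraction n \<in> borel_measurable M"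
  unfolding contraction_def by measurable

text \<open>By independence the mean of \<open>\<bar>contraction n \<omega>\<bar>\<close> is
  \<open>q ^ n\<close> with \<open>q < 1\<close>. The whole series thus has finite mean and
  converges almost surely.\<close>

lemma AE_contraction_summable: "AE \<omega> in M. summable (\<lambda>n. \<bar>contraction n \<omega>\<bar>)"
proof -
  define q where "q = (\<integral>e. \<bar>c e\<bar> \<partial>\<kappa>)"
  have int: "integrable \<kappa> (\<lambda>e. \<bar>c e\<bar>)"
    using c_le_1 by (intro noise.integrable_const_bound[of _ 1]) auto
  have q0: "0 \<le> q" by (simp add: q_def)
  \<comment> \<open>Otherwise the nonnegative function \<open>1 - \<bar>c e\<bar>\<close> would have
    integral 0, so \<open>\<bar>c e\<bar> = 1\<close> almost everywhere.\<close>
  have "q < 1"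
  proof (rule ccontr)
    assume "\<not> q < 1"
    have "(\<integral>e. 1 - \<bar>c e\<bar> \<partial>\<kappa>) = 1 - q"
      using int noise.prob_space by (simp add: q_def)
    moreover have "0 \<le> (\<integral>e. 1 - \<bar>c e\<bar> \<partial>\<kappa>)"
      using c_le_1 by (intro integral_nonneg_AE) auto
    ultimately have "(\<integral>e. 1 - \<bar>c e\<bar> \<partial>\<kappa>) = 0"
      using \<open>\<not> q < 1\<close> by simp
    then have "AE e in \<kappa>. 1 - \<bar>c e\<bar> = 0"
      using c_le_1 int by (subst (asm) integral_nonneg_eq_0_iff_AE) auto
    then show False using c_not_1 by simp
  qed
  have "(\<integral>\<^sup>+\<omega>. ennreal \<bar>contraction n \<omega>\<bar> \<partial>M) = ennreal (q ^ n)" for n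
  proof -
    have "indep_vars (\<lambda>_. borel) (\<lambda>i \<omega>. ennreal \<bar>c (\<xi> i \<omega>)\<bar>) {1..n}"
      by (rule indep_vars_compose2[OF indep_vars_subset[OF indep]]) auto
    then have "(\<integral>\<^sup>+\<omega>. (\<Prod>i\<in>{1..n}. ennreal \<bar>c (\<xi> i \<omega>)\<bar>) \<partial>M) = (\<Prod>i\<in>{1..n}. \<integral>\<^sup>+\<omega>. ennreal \<bar>c (\<xi> i \<omega>)\<bar> \<partial>M)"
      by (intro indep_vars_nn_integral) auto
    also have "\<dots> = (\<Prod>i\<in>{1..n}. ennreal q)"
    proof (rule prod.cong[OF refl])
      fix i assume "i \<in> {1..n}"
      then have i: "i \<ge> 1" by simp
      have "(\<integral>\<^sup>+\<omega>. ennreal \<bar>c (\<xi> i \<omega>)\<bar> \<partial>M) = (\<integral>\<^sup>+e. ennreal \<bar>c e\<bar> \<partial>distr M borel (\<xi> i))"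
        using i by (subst nn_integral_distr) auto
      also have "\<dots> = ennreal q"
        unfolding law[OF i] q_def using int by (intro nn_integral_eq_integral) auto
      finally show "(\<integral>\<^sup>+\<omega>. ennreal \<bar>c (\<xi> i \<omega>)\<bar> \<partial>M) = ennreal q" .
    qed
    also have "\<dots> = ennreal (q ^ n)"
      using q0 by (simp add: ennreal_power)
    finally show ?thesis
      by (simp add: contraction_def abs_prod prod_ennreal)
  qed
  then have "(\<integral>\<^sup>+\<omega>. (\<Sum>n. ennreal \<bar>contraction n \<omega>\<bar>) \<partial>M) = (\<Sum>n. ennreal (q ^ n))"
    by (subst nn_integral_suminf) auto
  also have "\<dots> = ennreal (\<Sum>n. q ^ n)"
    using q0 \<open>q < 1\<close> by (intro suminf_ennreal2 summable_geometric) auto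
  finally have "(\<integral>\<^sup>+\<omega>. (\<Sum>n. ennreal \<bar>contraction n \<omega>\<bar>) \<partial>M) \<noteq> \<infinity>"
    by simp
  then have "AE \<omega> in M. (\<Sum>n. ennreal \<bar>contraction n \<omega>\<bar>) \<noteq> \<infinity>"
    by (intro nn_integral_noteq_infinite) auto
  then show ?thesis
    by eventually_elim (auto intro: summable_suminf_not_top)
qed

lemma AE_contraction_tendsto_0: "AE \<omega> in M. (\<lambda>n. contraction n \<omega>) \<longlonglongrightarrow> 0"
  using AE_contraction_summable
  by eventually_elim (auto dest: summable_LIMSEQ_zero simp: tendsto_rabs_zero_iff)

text \<open>Both orders of integration are needed: the backward chain integrates the newest noise
  first, the forward chain integrates it last.\<close>

lemma integral_chain_next:
  fixes g :: "(real \<times> real) \<times> 'e \<Rightarrow> complex"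
  assumes h: "case_prod h \<in> borel \<Otimes>\<^sub>M borel \<rightarrow>\<^sub>M borel"
    and g: "g \<in> borel_measurable (borel \<Otimes>\<^sub>M borel)" and bound: "\<And>x. norm (g x) \<le> 1"
  defines "Z \<equiv> \<lambda>n \<omega>. markov_chain h (1, 0) (\<lambda>i. \<xi> i \<omega>) n"
  shows "(\<integral>\<omega>. g (Z n \<omega>, \<xi> (Suc n) \<omega>) \<partial>M) = (\<integral>\<omega>. (\<integral>e. g (Z n \<omega>, e) \<partial>\<kappa>) \<partial>M)"
    and "(\<integral>\<omega>. g (Z n \<omega>, \<xi> (Suc n) \<omega>) \<partial>M) = (\<integral>e. (\<integral>\<omega>. g (Z n \<omega>, e) \<partial>M) \<partial>\<kappa>)"
proof -
  have Z [measurable]: "Z n \<in> borel_measurable M"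
    unfolding Z_def by (rule measurable_markov_chain[OF h]) auto
  have joint: "distr M (borel \<Otimes>\<^sub>M borel) (\<lambda>\<omega>. (Z n \<omega>, \<xi> (Suc n) \<omega>)) = distr M borel (Z n) \<Otimes>\<^sub>M \<kappa>"
    unfolding Z_def using distr_markov_chain_next[OF indep h] by (simp add: law)
  interpret D: prob_space "distr M borel (Z n)"
    by (rule prob_space_distr) measurable
  interpret D: pair_prob_space "distr M borel (Z n)" \<kappa> ..
  interpret P: pair_prob_space M \<kappa> ..
  have g1: "g \<in> borel_measurable (distr M borel (Z n) \<Otimes>\<^sub>M \<kappa>)"
    using g by (simp cong: measurable_cong_sets add: sets_noise)
  have g1': "(\<lambda>x. \<integral>e. g (x, e) \<partial>\<kappa>) \<in> borel_measurable borel"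
    using g by measurable
  have g2: "(\<lambda>(\<omega>, e). g (Z n \<omega>, e)) \<in> borel_measurable (M \<Otimes>\<^sub>M \<kappa>)"
    using g by measurable
  have "(\<integral>\<omega>. g (Z n \<omega>, \<xi> (Suc n) \<omega>) \<partial>M) = (\<integral>z. g z \<partial>distr M (borel \<Otimes>\<^sub>M borel) (\<lambda>\<omega>. (Z n \<omega>, \<xi> (Suc n) \<omega>)))"
    using g by (subst integral_distr) auto
  also have "\<dots> = (\<integral>x. (\<integral>e. g (x, e) \<partial>\<kappa>) \<partial>distr M borel (Z n))"
    unfolding joint using g1 bound
    by (intro D.integral_fst'[symmetric] D.integrable_const_bound[of _ 1]) auto
  also have "\<dots> = (\<integral>\<omega>. (\<integral>e. g (Z n \<omega>, e) \<partial>\<kappa>) \<partial>M)"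
    using g1' by (subst integral_distr) auto
  finally show *: "(\<integral>\<omega>. g (Z n \<omega>, \<xi> (Suc n) \<omega>) \<partial>M) = (\<integral>\<omega>. (\<integral>e. g (Z n \<omega>, e) \<partial>\<kappa>) \<partial>M)" .
  show "(\<integral>\<omega>. g (Z n \<omega>, \<xi> (Suc n) \<omega>) \<partial>M) = (\<integral>e. (\<integral>\<omega>. g (Z n \<omega>, e) \<partial>M) \<partial>\<kappa>)"
    unfolding * using g2
    by (intro P.Fubini_integral[symmetric] P.integrable_const_bound[of _ 1])
      (auto intro!: AE_I2 simp: bound split: prod.split)
qed

section \<open>Characteristic functions under a stationary law\<close>

lemma stationary_real_distribution: "stationary \<nu> \<Longrightarrow> real_distribution \<nu>"
  by (simp add: stationary_def real_distribution_def real_distribution_axioms_def)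

text \<open>The fixed-point equation in Fourier form: for a fixed noise value \<open>e\<close> the
  affine map rescales the frequency by \<open>c e\<close> and contributes the phase of
  \<open>d e\<close>.\<close>

lemma char_stationary:
  assumes "stationary \<nu>"
  shows "(\<integral>e. iexp (t * d e) * char \<nu> (t * c e) \<partial>\<kappa>) = char \<nu> t"
proof -
  interpret \<nu>: real_distribution \<nu>
    using assms by (rule stationary_real_distribution)
  interpret P: pair_prob_space \<nu> \<kappa> ..
  have "char \<nu> t = char (distr (\<nu> \<Otimes>\<^sub>M \<kappa>) borel (\<lambda>(x, e). c e * x + d e)) t"
    using assms by (simp add: stationary_def)
  also have "\<dots> = (\<integral>z. iexp (t * (c (snd z) * fst z + d (snd z))) \<partial>(\<nu> \<Otimes>\<^sub>M \<kappa>))"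
    unfolding char_def by (subst integral_distr) (auto simp: split_beta')
  also have "\<dots> = (\<integral>e. (\<integral>x. iexp (t * (c e * x + d e)) \<partial>\<nu>) \<partial>\<kappa>)"
    by (subst P.integral_snd) (auto intro!: P.integrable_const_bound[of _ 1] simp: split_beta')
  also have "\<dots> = (\<integral>e. iexp (t * d e) * char \<nu> (t * c e) \<partial>\<kappa>)"
  proof (rule Bochner_Integration.integral_cong[OF refl])
    fix e
    have "iexp (t * (c e * x + d e)) = iexp (t * d e) * iexp (t * c e * x)" for x
      by (simp add: exp_add[symmetric] algebra_simps)
    then show "(\<integral>x. iexp (t * (c e * x + d e)) \<partial>\<nu>) = iexp (t * d e) * char \<nu> (t * c e)"
      by (simp add: char_def)
  qed
  finally show ?thesis by simp
qed

text \<open>The next two integrals are the characteristic function of the iteration started from an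
  independent variable with the stationary law, which leaves this law invariant; integrating out
  the starting point avoids enlarging the probability space.\<close>

lemma integral_char_fwd_chain:
  assumes \<nu>: "stationary \<nu>"
  shows "(\<integral>\<omega>. char \<nu> (t * fst (fwd_chain n \<omega>)) * iexp (t * snd (fwd_chain n \<omega>)) \<partial>M) = char \<nu> t"
\<comment> \<open>The newest map acts last and changes the frequency from \<open>t\<close> to
  \<open>t * c e\<close>, so the hypothesis is needed at every frequency.\<close>
proof (induction n arbitrary: t)
  case 0
  then show ?case using prob_space by simp
next
  case (Suc n)
  interpret \<nu>: real_distribution \<nu>
    using \<nu> by (rule stationary_real_distribution)
  define g where "g z = char \<nu> (t * (fst (fst z) * c (snd z))) * iexp (t * (c (snd z) * snd (fst z) + d (snd z)))"
    for z :: "(real \<times> real) \<times> 'e"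
  have g: "g \<in> borel_measurable (borel \<Otimes>\<^sub>M borel)"
    unfolding g_def borel_prod[symmetric] by measurable
  have bound: "norm (g z) \<le> 1" for z
    by (simp add: g_def norm_mult \<nu>.cmod_char_le_1)
  have "(\<integral>\<omega>. char \<nu> (t * fst (fwd_chain (Suc n) \<omega>)) * iexp (t * snd (fwd_chain (Suc n) \<omega>)) \<partial>M) =
      (\<integral>\<omega>. g (fwd_chain n \<omega>, \<xi> (Suc n) \<omega>) \<partial>M)"
    by (simp add: g_def fwd_def)
  also have "\<dots> = (\<integral>e. (\<integral>\<omega>. g (fwd_chain n \<omega>, e) \<partial>M) \<partial>\<kappa>)"
    by (rule integral_chain_next(2)[OF measurable_fwd g bound])
  also have "\<dots> = (\<integral>e. iexp (t * d e) * char \<nu> (t * c e) \<partial>\<kappa>)"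
  proof (rule Bochner_Integration.integral_cong[OF refl])
    fix e
    have "g (fwd_chain n \<omega>, e) = iexp (t * d e) *
        (char \<nu> (t * c e * fst (fwd_chain n \<omega>)) * iexp (t * c e * snd (fwd_chain n \<omega>)))" for \<omega>
      by (simp add: g_def exp_add ring_distribs ac_simps)
    then show "(\<integral>\<omega>. g (fwd_chain n \<omega>, e) \<partial>M) = iexp (t * d e) * char \<nu> (t * c e)"
      using Suc.IH[of "t * c e"] by simp
  qed
  also have "\<dots> = char \<nu> t"
    by (rule char_stationary[OF \<nu>])
  finally show ?case .
qed

lemma integral_char_bwd_chain:
  assumes \<nu>: "stationary \<nu>"
  shows "(\<integral>\<omega>. char \<nu> (t * fst (bwd_chain n \<omega>)) * iexp (t * snd (bwd_chain n \<omega>)) \<partial>M) = char \<nu> t"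
proof (induction n)
  case 0
  then show ?case using prob_space by simp
next
  case (Suc n)
  interpret \<nu>: real_distribution \<nu>
    using \<nu> by (rule stationary_real_distribution)
  define g where "g z = char \<nu> (t * (fst (fst z) * c (snd z))) * iexp (t * (snd (fst z) + fst (fst z) * d (snd z)))"
    for z :: "(real \<times> real) \<times> 'e"
  have g: "g \<in> borel_measurable (borel \<Otimes>\<^sub>M borel)"
    unfolding g_def borel_prod[symmetric] by measurable
  have bound: "norm (g z) \<le> 1" for z
    by (simp add: g_def norm_mult \<nu>.cmod_char_le_1)
  have "(\<integral>\<omega>. char \<nu> (t * fst (bwd_chain (Suc n) \<omega>)) * iexp (t * snd (bwd_chain (Suc n) \<omega>)) \<partial>M) =
      (\<integral>\<omega>. g (bwd_chain n \<omega>, \<xi> (Suc n) \<omega>) \<partial>M)"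
    by (simp add: g_def bwd_def)
  \<comment> \<open>Here the newest map acts first, directly on the stationary start. Averaging over
    its noise absorbs it by stationarity at the random frequency
    \<open>t * fst (bwd_chain n \<omega>)\<close>.\<close>
  also have "\<dots> = (\<integral>\<omega>. (\<integral>e. g (bwd_chain n \<omega>, e) \<partial>\<kappa>) \<partial>M)"
    by (rule integral_chain_next(1)[OF measurable_bwd g bound])
  also have "\<dots> = (\<integral>\<omega>. char \<nu> (t * fst (bwd_chain n \<omega>)) * iexp (t * snd (bwd_chain n \<omega>)) \<partial>M)"
  proof (rule Bochner_Integration.integral_cong[OF refl])
    fix \<omega>
    have "g (bwd_chain n \<omega>, e) = iexp (t * snd (bwd_chain n \<omega>)) *
        (iexp (t * fst (bwd_chain n \<omega>) * d e) * char \<nu> (t * fst (bwd_chain n \<omega>) * c e))" for e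
      by (simp add: g_def exp_add ring_distribs ac_simps)
    then show "(\<integral>e. g (bwd_chain n \<omega>, e) \<partial>\<kappa>) =
        char \<nu> (t * fst (bwd_chain n \<omega>)) * iexp (t * snd (bwd_chain n \<omega>))"
      using char_stationary[OF \<nu>, of "t * fst (bwd_chain n \<omega>)"] by (simp add: mult.commute)
  qed
  also have "\<dots> = char \<nu> t"
    by (fact Suc.IH)
  finally show ?case .
qed

text \<open>Starting at \<open>x\<close> is compared with starting at an independent stationary
  variable, for which the characteristic function is \<open>char \<nu> t\<close> at every
  \<open>n\<close>. The start enters only through the factor \<open>contraction n \<omega>\<close>,
  which tends to 0. The chain \<open>Z\<close> is left open to serve both orders of
  composition.\<close>

lemma char_affine_tendsto:
  assumes \<nu>: "stationary \<nu>"
    and Z [measurable]: "\<And>n. Z n \<in> borel_measurable M" and fst_Z: "\<And>n \<omega>. fst (Z n \<omega>) = contraction n \<omega>"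
    and inv: "\<And>n. (\<integral>\<omega>. char \<nu> (t * fst (Z n \<omega>)) * iexp (t * snd (Z n \<omega>)) \<partial>M) = char \<nu> t"
  shows "(\<lambda>n. char (distr M borel (\<lambda>\<omega>. contraction n \<omega> * x + snd (Z n \<omega>))) t) \<longlonglongrightarrow> char \<nu> t"
proof -
  interpret \<nu>: real_distribution \<nu>
    using \<nu> by (rule stationary_real_distribution)
  have snd_Z [measurable]: "(\<lambda>\<omega>. snd (Z n \<omega>)) \<in> borel_measurable M" for n
    using measurable_compose[OF Z[of n], of snd borel] by (simp add: borel_measurable_continuous_onI continuous_on_snd)
  \<comment> \<open>The difference of the two integrands; the second has the stationary start
    already integrated out. Its norm is at most 2, as both terms of the difference have norm at most
    1 and the phase has norm 1.\<close>
  define \<delta> where "\<delta> n \<omega> = (iexp (t * contraction n \<omega> * x) - char \<nu> (t * contraction n \<omega>)) * iexp (t * snd (Z n \<omega>))" for n \<omega>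
  have \<delta> [measurable]: "\<delta> n \<in> borel_measurable M" for n
    unfolding \<delta>_def by measurable
  have "(\<lambda>n. \<integral>\<omega>. \<delta> n \<omega> \<partial>M) \<longlonglongrightarrow> (\<integral>\<omega>. 0 \<partial>M)"
  proof (rule integral_dominated_convergence)
    show "integrable M (\<lambda>_. 2 :: real)" by simp
    show "AE \<omega> in M. (\<lambda>n. \<delta> n \<omega>) \<longlonglongrightarrow> 0"
      using AE_contraction_tendsto_0
    proof eventually_elim
      case (elim \<omega>)
      have "(\<lambda>n. iexp (t * contraction n \<omega> * x)) \<longlonglongrightarrow> iexp (t * 0 * x)"
        by (rule isCont_tendsto_compose[OF isCont_iexp]) (intro tendsto_intros elim)
      moreover have "(\<lambda>n. char \<nu> (t * contraction n \<omega>)) \<longlonglongrightarrow> char \<nu> (t * 0)"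
        by (rule isCont_tendsto_compose[OF \<nu>.isCont_char]) (intro tendsto_intros elim)
      ultimately have "(\<lambda>n. iexp (t * contraction n \<omega> * x) - char \<nu> (t * contraction n \<omega>)) \<longlonglongrightarrow>
          iexp (t * 0 * x) - char \<nu> (t * 0)"
        by (rule tendsto_diff)
      then have "(\<lambda>n. norm (iexp (t * contraction n \<omega> * x) - char \<nu> (t * contraction n \<omega>))) \<longlonglongrightarrow> 0"
        by (intro tendsto_norm_zero) (simp add: \<nu>.char_zero)
      then have "(\<lambda>n. norm (\<delta> n \<omega>)) \<longlonglongrightarrow> 0"
        unfolding \<delta>_def norm_mult norm_exp_i_times by simp
      then show ?case
        by (rule tendsto_norm_zero_cancel)
    qed
    show "AE \<omega> in M. norm (\<delta> n \<omega>) \<le> 2" for n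
    proof (rule AE_I2)
      fix \<omega>
      have "norm (iexp u - char \<nu> v) \<le> 2" for u v
        using norm_triangle_ineq4[of "iexp u" "char \<nu> v"] \<nu>.cmod_char_le_1[of v] by simp
      then show "norm (\<delta> n \<omega>) \<le> 2"
        unfolding \<delta>_def norm_mult norm_exp_i_times by (simp del: of_real_mult)
    qed
  qed auto
  moreover have "(\<integral>\<omega>. \<delta> n \<omega> \<partial>M) = char (distr M borel (\<lambda>\<omega>. contraction n \<omega> * x + snd (Z n \<omega>))) t - char \<nu> t" for n
  proof -
    have int1: "integrable M (\<lambda>\<omega>. iexp (t * contraction n \<omega> * x) * iexp (t * snd (Z n \<omega>)))"
      by (rule integrable_const_bound[of _ 1], unfold norm_mult norm_exp_i_times) auto
    have int2: "integrable M (\<lambda>\<omega>. char \<nu> (t * contraction n \<omega>) * iexp (t * snd (Z n \<omega>)))"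
      by (rule integrable_const_bound[of _ 1], unfold norm_mult norm_exp_i_times)
        (auto simp: \<nu>.cmod_char_le_1)
    have "char (distr M borel (\<lambda>\<omega>. contraction n \<omega> * x + snd (Z n \<omega>))) t =
        (\<integral>\<omega>. iexp (t * contraction n \<omega> * x) * iexp (t * snd (Z n \<omega>)) \<partial>M)"
      unfolding char_def by (subst integral_distr) (simp_all add: exp_add[symmetric] ring_distribs mult.assoc)
    moreover have "char \<nu> t = (\<integral>\<omega>. char \<nu> (t * contraction n \<omega>) * iexp (t * snd (Z n \<omega>)) \<partial>M)"
      using inv[of n] by (simp add: fst_Z)
    ultimately show ?thesis
      using int1 int2 by (simp add: \<delta>_def left_diff_distrib del: of_real_mult)
  qed
  ultimately show ?thesis
    by (simp add: LIM_zero_iff)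
qed

section \<open>Limit law of the forward iterates and uniqueness\<close>

lemma char_forward_iter_tendsto:
  assumes "stationary \<nu>"
  shows "(\<lambda>n. char (distr M borel (\<lambda>\<omega>. forward_iter (step \<omega>) n x)) t) \<longlonglongrightarrow> char \<nu> t"
  unfolding forward_iter_eq
  using assms by (intro char_affine_tendsto integral_char_fwd_chain measurable_fwd_chain fst_fwd_chain)

lemma measurable_forward_iter: "(\<lambda>\<omega>. forward_iter (step \<omega>) n x) \<in> borel_measurable M"
  unfolding forward_iter_eq
  using measurable_compose[OF measurable_fwd_chain[of n], of snd borel]
  by (simp add: borel_measurable_continuous_onI continuous_on_snd)

theorem weak_conv_forward_iter:
  assumes "stationary \<nu>"
  shows "weak_conv_m (\<lambda>n. distr M borel (\<lambda>\<omega>. forward_iter (step \<omega>) n x)) \<nu>"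
  using assms by (intro levy_continuity char_forward_iter_tendsto stationary_real_distribution
      real_distribution_distr measurable_forward_iter)

text \<open>The forward iterates do not involve the stationary law, yet their characteristic
  functions converge to that of each one.\<close>

theorem stationary_unique:
  assumes "stationary \<nu>" "stationary \<nu>'"
  shows "\<nu> = \<nu>'"
proof (rule Levy_uniqueness)
  show "char \<nu> = char \<nu>'"
    using char_forward_iter_tendsto[OF assms(1)] char_forward_iter_tendsto[OF assms(2)]
    by (intro ext) (rule LIMSEQ_unique)
qed (use assms stationary_real_distribution in auto)

section \<open>Almost sure convergence of the backward iterates\<close>

text \<open>A new innermost map only adds a term to the intercept. The intercepts are therefore
  partial sums of a series dominated by the summable contraction factors.\<close>

lemma AE_convergent_bwd_chain:
  assumes "AE e in \<kappa>. \<bar>d e\<bar> \<le> 1"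
  shows "AE \<omega> in M. convergent (\<lambda>n. snd (bwd_chain n \<omega>))"
proof -
  have "AE \<omega> in M. \<forall>n. \<bar>d (\<xi> (Suc n) \<omega>)\<bar> \<le> 1"
    unfolding AE_all_countable using AE_noise[OF assms] by simp
  then show ?thesis
    using AE_contraction_summable
  proof eventually_elim
    case (elim \<omega>)
    have "summable (\<lambda>n. contraction n \<omega> * d (\<xi> (Suc n) \<omega>))"
      using elim by (intro summable_comparison_test[OF _ elim(2)])
        (auto simp: abs_mult mult_left_le)
    moreover have "snd (bwd_chain n \<omega>) = (\<Sum>k<n. contraction k \<omega> * d (\<xi> (Suc k) \<omega>))" for n
    proof (induction n)
      case (Suc n)
      have "snd (bwd_chain (Suc n) \<omega>) = snd (bwd_chain n \<omega>) + fst (bwd_chain n \<omega>) * d (\<xi> (Suc n) \<omega>)"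
        by (simp add: bwd_def)
      then show ?case
        unfolding fst_bwd_chain Suc.IH by simp
    qed simp
    ultimately show ?case
      by (simp add: summable_iff_convergent)
  qed
qed

text \<open>The intercepts converge to \<open>Y\<close>, and the slope term vanishes uniformly over
  a bounded set of starting points.\<close>

theorem backward_iter_converges:
  assumes \<nu>: "stationary \<nu>" and d: "AE e in \<kappa>. \<bar>d e\<bar> \<le> 1" and S: "bounded S"
  shows "\<exists>Y \<in> borel_measurable M. distr M borel Y = \<nu> \<and>
    (AE \<omega> in M. uniform_limit S (\<lambda>n x. backward_iter (step \<omega>) n x) (\<lambda>x. Y \<omega>) sequentially)"
proof -
  \<comment> \<open>Where the intercepts diverge, on a null set, \<open>lim\<close> has an
    unspecified value.\<close>
  define Y where "Y \<omega> = lim (\<lambda>n. snd (bwd_chain n \<omega>))" for \<omega>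
  have [measurable]: "(\<lambda>\<omega>. snd (bwd_chain n \<omega>)) \<in> borel_measurable M" for n
    using measurable_compose[OF measurable_bwd_chain[of n], of snd borel]
    by (simp add: borel_measurable_continuous_onI continuous_on_snd)
  have Y [measurable]: "Y \<in> borel_measurable M"
    unfolding Y_def by measurable
  have lim_Y: "AE \<omega> in M. (\<lambda>n. snd (bwd_chain n \<omega>)) \<longlonglongrightarrow> Y \<omega>"
    using AE_convergent_bwd_chain[OF d] by eventually_elim (simp add: Y_def convergent_LIMSEQ_iff)
  have "distr M borel Y = \<nu>"
  proof (rule Levy_uniqueness)
    have "char (distr M borel Y) t = char \<nu> t" for t
    proof (rule LIMSEQ_unique)
      \<comment> \<open>From the starting point 0 the iterate is the intercept itself, so this limit
        and the one from dominated convergence concern the same sequence.\<close>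
      show "(\<lambda>n. char (distr M borel (\<lambda>\<omega>. contraction n \<omega> * 0 + snd (bwd_chain n \<omega>))) t) \<longlonglongrightarrow> char \<nu> t"
        using \<nu> by (intro char_affine_tendsto integral_char_bwd_chain measurable_bwd_chain fst_bwd_chain)
      have "(\<lambda>n. \<integral>\<omega>. iexp (t * snd (bwd_chain n \<omega>)) \<partial>M) \<longlonglongrightarrow> (\<integral>\<omega>. iexp (t * Y \<omega>) \<partial>M)"
      proof (rule integral_dominated_convergence)
        show "integrable M (\<lambda>_. 1 :: real)" by simp
        show "AE \<omega> in M. (\<lambda>n. iexp (t * snd (bwd_chain n \<omega>))) \<longlonglongrightarrow> iexp (t * Y \<omega>)"
          using lim_Y by eventually_elim (intro isCont_tendsto_compose[OF isCont_iexp] tendsto_intros)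
      qed auto
      then show "(\<lambda>n. char (distr M borel (\<lambda>\<omega>. contraction n \<omega> * 0 + snd (bwd_chain n \<omega>))) t) \<longlonglongrightarrow> char (distr M borel Y) t"
        by (simp add: char_def integral_distr)
    qed
    then show "char (distr M borel Y) = char \<nu>" ..
  qed (use \<nu> stationary_real_distribution in auto)
  moreover have "AE \<omega> in M. uniform_limit S (\<lambda>n x. backward_iter (step \<omega>) n x) (\<lambda>x. Y \<omega>) sequentially"
    using lim_Y AE_contraction_tendsto_0
  proof eventually_elim
    case (elim \<omega>)
    obtain K where K: "\<And>x. x \<in> S \<Longrightarrow> \<bar>x\<bar> \<le> K"
      using S by (auto simp: bounded_iff)
    have "(\<lambda>n. \<bar>contraction n \<omega>\<bar> * K + \<bar>snd (bwd_chain n \<omega>) - Y \<omega>\<bar>) \<longlonglongrightarrow> \<bar>0\<bar> * K + \<bar>Y \<omega> - Y \<omega>\<bar>"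
      by (intro tendsto_intros elim)
    then have lim: "(\<lambda>n. \<bar>contraction n \<omega>\<bar> * K + \<bar>snd (bwd_chain n \<omega>) - Y \<omega>\<bar>) \<longlonglongrightarrow> 0"
      by simp
    show ?case
    proof (rule uniform_limitI)
      fix \<epsilon> :: real assume "0 < \<epsilon>"
      then have "\<forall>\<^sub>F n in sequentially. \<bar>contraction n \<omega>\<bar> * K + \<bar>snd (bwd_chain n \<omega>) - Y \<omega>\<bar> < \<epsilon>"
        using lim by (rule order_tendstoD(2)[rotated])
      then show "\<forall>\<^sub>F n in sequentially. \<forall>x\<in>S. dist (backward_iter (step \<omega>) n x) (Y \<omega>) < \<epsilon>"
      proof eventually_elim
        case (elim n)
        show ?case
        proof
          fix x assume "x \<in> S"
          have "dist (backward_iter (step \<omega>) n x) (Y \<omega>) \<le> \<bar>contraction n \<omega> * x\<bar> + \<bar>snd (bwd_chain n \<omega>) - Y \<omega>\<bar>"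
            by (simp add: backward_iter_eq dist_real_def)
          also have "\<bar>contraction n \<omega> * x\<bar> \<le> \<bar>contraction n \<omega>\<bar> * K"
            using K[OF \<open>x \<in> S\<close>] by (simp add: abs_mult mult_left_mono)
          finally show "dist (backward_iter (step \<omega>) n x) (Y \<omega>) < \<epsilon>"
            using elim by simp
        qed
      qed
    qed
  qed
  ultimately show ?thesis
    using Y by blast
qed

end

subsection \<open>The gamma and beta equations\<close>

theorem proposition2:
  fixes a b :: real
    and N :: "'n measure" and A B :: "'n \<Rightarrow> real" and \<mu> :: "(real \<times> real) measure"
    and M :: "'m measure" and As Bs Vs :: "nat \<Rightarrow> 'm \<Rightarrow> real"
  defines "F \<equiv> \<lambda>\<omega> n. F_map (As n \<omega>) (Bs n \<omega>)"
    and "G \<equiv> \<lambda>\<omega> n. G_map (As n \<omega>) (Bs n \<omega>) (Vs n \<omega>)"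
  assumes "a > 0" and "b > 0"
    and "prob_space N"
    and "A \<in> borel_measurable N" and "B \<in> borel_measurable N"
    and "\<forall>\<omega>\<in>space N. A \<omega> \<in> {0..1} \<and> B \<omega> \<in> {0..1}"
    and "\<mu> = distr N borel (\<lambda>\<omega>. (A \<omega>, B \<omega>))"
    and "\<P>(\<omega> in N. \<bar>A \<omega> - B \<omega>\<bar> = 1) < 1" and "\<P>(\<omega> in N. A \<omega> = 1) < 1"
    and "prob_space M"
    and "prob_space.indep_vars M (\<lambda>_. borel) (\<lambda>n \<omega>. ((As n \<omega>, Bs n \<omega>), Vs n \<omega>)) {1..}"
    and "\<forall>n\<ge>1. distr M borel (\<lambda>\<omega>. ((As n \<omega>, Bs n \<omega>), Vs n \<omega>)) = \<mu> \<Otimes>\<^sub>M gamma_law b"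
    and "unique_solution (gamma_eq_solution \<mu> b) (gamma_law a) \<or>
         unique_solution (beta_eq_solution \<mu>) (beta_law a b)"
  shows "unique_solution (gamma_eq_solution \<mu> b) (gamma_law a) \<and>
         unique_solution (beta_eq_solution \<mu>) (beta_law a b) \<and>
         (\<exists>Y \<in> borel_measurable M. distr M borel Y = beta_law a b \<and>
            (AE \<omega> in M. uniform_limit {0..1} (\<lambda>n x. backward_iter (F \<omega>) n x) (\<lambda>x. Y \<omega>) sequentially)) \<and>
         (\<forall>x\<in>{0..1}. weak_conv_m (\<lambda>n. distr M borel (\<lambda>\<omega>. forward_iter (F \<omega>) n x)) (beta_law a b)) \<and>
         (\<forall>x'\<in>{0<..}. weak_conv_m (\<lambda>n. distr M borel (\<lambda>\<omega>. forward_iter (G \<omega>) n x')) (gamma_law a))"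
proof -
  have F: "F = (\<lambda>\<omega> n. F_map (As n \<omega>) (Bs n \<omega>))" and G: "G = (\<lambda>\<omega> n. G_map (As n \<omega>) (Bs n \<omega>) (Vs n \<omega>))"
    by (simp_all add: assms(1,2))
  have a: "a > 0" and b: "b > 0" and A [measurable]: "A \<in> borel_measurable N" and B [measurable]: "B \<in> borel_measurable N"
    and AB: "\<forall>\<omega>\<in>space N. A \<omega> \<in> {0..1} \<and> B \<omega> \<in> {0..1}"
    and \<mu>: "\<mu> = distr N borel (\<lambda>\<omega>. (A \<omega>, B \<omega>))"
    and ne1: "\<P>(\<omega> in N. \<bar>A \<omega> - B \<omega>\<bar> = 1) < 1" and ne2: "\<P>(\<omega> in N. A \<omega> = 1) < 1"
    and ind: "prob_space.indep_vars M (\<lambda>_. borel) (\<lambda>n \<omega>. ((As n \<omega>, Bs n \<omega>), Vs n \<omega>)) {1..}"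
    and law: "\<And>n. n \<ge> 1 \<Longrightarrow> distr M borel (\<lambda>\<omega>. ((As n \<omega>, Bs n \<omega>), Vs n \<omega>)) = \<mu> \<Otimes>\<^sub>M gamma_law b"
    and sol: "unique_solution (gamma_eq_solution \<mu> b) (gamma_law a) \<or>
         unique_solution (beta_eq_solution \<mu>) (beta_law a b)"
    using assms by blast+
  interpret N: prob_space N by fact
  interpret M: prob_space M by fact
  interpret \<mu>: prob_space \<mu>
    unfolding \<mu> by (rule N.prob_space_distr) measurable
  interpret V: prob_space "gamma_law b"
    using b by (rule prob_space_gamma_law)
  interpret \<mu>V: pair_prob_space \<mu> "gamma_law b" ..
  have sets_\<mu> [measurable_cong]: "sets \<mu> = sets borel"
    by (simp add: \<mu>)
  have fs [measurable]: "fst \<in> borel_measurable (borel :: (real \<times> real) measure)"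
      "snd \<in> borel_measurable (borel :: (real \<times> real) measure)"
    by (simp_all add: borel_measurable_continuous_onI continuous_on_fst continuous_on_snd)
  have \<mu>01: "AE z in \<mu>. 0 \<le> fst z \<and> fst z \<le> 1 \<and> 0 \<le> snd z \<and> snd z \<le> 1"
    unfolding \<mu> using AB by (subst AE_distr_iff) (auto intro!: AE_I2)
  have not_AE: "\<not> (AE z in \<mu>. P z)"
    if P: "Measurable.pred borel P" and "\<P>(\<omega> in N. P (A \<omega>, B \<omega>)) < 1" for P
  proof
    assume "AE z in \<mu>. P z"
    then have "AE \<omega> in N. P (A \<omega>, B \<omega>)"
      unfolding \<mu> by (rule AE_distrD[rotated]) measurable
    moreover have "Measurable.pred N (\<lambda>\<omega>. P (A \<omega>, B \<omega>))"
      using P by measurable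
    ultimately have "\<P>(\<omega> in N. P (A \<omega>, B \<omega>)) = 1"
      by (subst N.prob_Collect_eq_1) auto
    with that show False by simp
  qed
  \<comment> \<open>Moves almost sure statements about \<open>(A, B)\<close> to the noise that also
    contains the gamma variable.\<close>
  have fst_\<mu>V: "distr (\<mu> \<Otimes>\<^sub>M gamma_law b) \<mu> fst = \<mu>"
    by (rule V.distr_pair_fst)

  \<comment> \<open>Gamma equation: slope \<open>A\<close>, intercept \<open>B * V\<close>.\<close>
  interpret gamma: random_affine_iteration M "\<mu> \<Otimes>\<^sub>M gamma_law b"
    "\<lambda>n \<omega>. ((As n \<omega>, Bs n \<omega>), Vs n \<omega>)" "\<lambda>e. fst (fst e)" "\<lambda>e. snd (fst e) * snd e"
  proof
    show "sets (\<mu> \<Otimes>\<^sub>M gamma_law b) = sets borel"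
      unfolding borel_prod[symmetric, where 'a = "real \<times> real" and 'b = real]
      by (intro sets_pair_measure_cong) (simp_all add: sets_\<mu>)
    show "(\<lambda>e. fst (fst e)) \<in> borel_measurable (borel :: ((real \<times> real) \<times> real) measure)"
      "(\<lambda>e. snd (fst e) * snd e) \<in> borel_measurable (borel :: ((real \<times> real) \<times> real) measure)"
      unfolding borel_prod[symmetric] by measurable
    have "AE z in \<mu>. \<bar>fst z\<bar> \<le> 1"
      using \<mu>01 by eventually_elim auto
    then show "AE e in \<mu> \<Otimes>\<^sub>M gamma_law b. \<bar>fst (fst e)\<bar> \<le> 1"
      by (subst (asm) fst_\<mu>V[symmetric], subst (asm) AE_distr_iff) auto
    have "\<not> (AE z in \<mu>. \<bar>fst z\<bar> = 1)"
    proof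
      assume "AE z in \<mu>. \<bar>fst z\<bar> = 1"
      \<comment> \<open>As \<open>A \<ge> 0\<close>, the slope has modulus 1 only where
        \<open>A = 1\<close>.\<close>
      then have "AE z in \<mu>. fst z = 1"
        using \<mu>01 by eventually_elim auto
      moreover have "\<not> (AE z in \<mu>. fst z = 1)"
        using ne2 by (intro not_AE) auto
      ultimately show False by simp
    qed
    then show "\<not> (AE e in \<mu> \<Otimes>\<^sub>M gamma_law b. \<bar>fst (fst e)\<bar> = 1)"
      by (subst (asm) fst_\<mu>V[symmetric], subst (asm) AE_distr_iff) auto
  qed (use ind law in auto)

  \<comment> \<open>Beta equation: \<open>A * x + B * (1 - x) = (A - B) * x + B\<close> has slope
    \<open>A - B\<close> and intercept \<open>B\<close>; its noise is the first component of the
    gamma noise.\<close>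
  interpret beta: random_affine_iteration M \<mu> "\<lambda>n \<omega>. (As n \<omega>, Bs n \<omega>)" "\<lambda>e. fst e - snd e" snd
  proof
    have fst_meas: "fst \<in> borel_measurable (borel :: ((real \<times> real) \<times> real) measure)"
      by (simp add: borel_measurable_continuous_onI continuous_on_fst)
    have "M.indep_vars (\<lambda>_. borel) (\<lambda>n \<omega>. fst ((As n \<omega>, Bs n \<omega>), Vs n \<omega>)) {1..}"
      by (rule M.indep_vars_compose2[OF ind fst_meas])
    then show "M.indep_vars (\<lambda>_. borel) (\<lambda>n \<omega>. (As n \<omega>, Bs n \<omega>)) {1..}"
      by simp
    show "distr M borel (\<lambda>\<omega>. (As n \<omega>, Bs n \<omega>)) = \<mu>" if n: "1 \<le> n" for n
    proof -
      have [measurable]: "(\<lambda>\<omega>. ((As n \<omega>, Bs n \<omega>), Vs n \<omega>)) \<in> borel_measurable M"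
        using gamma.measurable_xi[OF n] .
      have "distr M borel (\<lambda>\<omega>. (As n \<omega>, Bs n \<omega>)) = distr (\<mu> \<Otimes>\<^sub>M gamma_law b) borel fst"
        unfolding law[OF n, symmetric] using fst_meas by (subst distr_distr) (auto simp: comp_def)
      also have "\<dots> = distr (\<mu> \<Otimes>\<^sub>M gamma_law b) \<mu> fst"
        by (rule distr_cong) (simp_all add: sets_\<mu>)
      finally show ?thesis
        by (simp add: fst_\<mu>V)
    qed
    show "AE e in \<mu>. \<bar>fst e - snd e\<bar> \<le> 1"
      using \<mu>01 by eventually_elim auto
    show "\<not> (AE e in \<mu>. \<bar>fst e - snd e\<bar> = 1)"
      using ne1 by (intro not_AE) auto
  qed (use sets_\<mu> in auto)

  have gamma_stationary: "gamma.stationary = gamma_eq_solution \<mu> b"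
    by (simp add: fun_eq_iff gamma.stationary_def gamma_eq_solution_def split_beta')
  have beta_map: "\<alpha> * x + \<beta> * (1 - x) = (\<alpha> - \<beta>) * x + \<beta>" for \<alpha> \<beta> x :: real
    by (simp add: algebra_simps)
  have beta_stationary: "beta.stationary = beta_eq_solution \<mu>"
    by (simp add: fun_eq_iff beta.stationary_def beta_eq_solution_def split_beta' beta_map)
  have "gamma_eq_solution \<mu> b (gamma_law a) \<longleftrightarrow> beta_eq_solution \<mu> (beta_law a b)"
    using a b \<mu>.prob_space_axioms sets_\<mu> \<mu>01 by (rule gamma_eq_solution_iff_beta_eq_solution)
  \<comment> \<open>Either assumption supplies one stationary law, and the equivalence supplies the
    other; both uniqueness claims then follow from the contraction.\<close>
  with sol have gamma_sol: "gamma.stationary (gamma_law a)" and beta_sol: "beta.stationary (beta_law a b)"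
    by (auto simp: unique_solution_def gamma_stationary beta_stationary)
  have F_step: "F \<omega> = beta.step \<omega>" and G_step: "G \<omega> = gamma.step \<omega>" for \<omega>
    by (auto simp: fun_eq_iff F G F_map_def G_map_def algebra_simps)
  have "AE e in \<mu>. \<bar>snd e\<bar> \<le> 1"
    using \<mu>01 by eventually_elim auto
  then have backward: "\<exists>Y \<in> borel_measurable M. distr M borel Y = beta_law a b \<and>
      (AE \<omega> in M. uniform_limit {0..1} (\<lambda>n x. backward_iter (F \<omega>) n x) (\<lambda>x. Y \<omega>) sequentially)"
    unfolding F_step by (intro beta.backward_iter_converges[OF beta_sol]) auto
  have "unique_solution (gamma_eq_solution \<mu> b) (gamma_law a)"
    using gamma_sol gamma.stationary_unique unfolding unique_solution_def gamma_stationary by blast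
  moreover have "unique_solution (beta_eq_solution \<mu>) (beta_law a b)"
    using beta_sol beta.stationary_unique unfolding unique_solution_def beta_stationary by blast
  moreover have "weak_conv_m (\<lambda>n. distr M borel (\<lambda>\<omega>. forward_iter (F \<omega>) n x)) (beta_law a b)" for x
    unfolding F_step by (rule beta.weak_conv_forward_iter[OF beta_sol])
  moreover have "weak_conv_m (\<lambda>n. distr M borel (\<lambda>\<omega>. forward_iter (G \<omega>) n x)) (gamma_law a)" for x
    unfolding G_step by (rule gamma.weak_conv_forward_iter[OF gamma_sol])
  ultimately show ?thesis
    using backward by blast
qed

end
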